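(* Let $\mathcal{H}$ be the reproducing kernel Hilbert space of $1$-periodic zero-mean functions with inner product $\langle w,x\rangle_{\mathcal{H}}=\int_{[0,1]}w'(y)x'(y)\,dy$ and kernel $k(y,z)=\frac12B_2([y-z])$ described in the context, let $\Phi\colon[0,1]\to\mathcal{H}$ be the feature map associated with $k$ restricted to $[0,1]\times[0,1]$, let $\mathcal{C}=\operatorname{conv}(\{\Phi(y)\mid y\in[0,1]\})$ be the marginal polytope, and let $\mu=0$ such that $f(x)=\frac12\|x\|_{\mathcal{H}}^2$. Let $T\in\mathbb{N}$ and $\eta_t=\frac{1}{t+1}$ for all $t\in\mathbb{Z}$. Then, for the iterates $x_t$ of the Frank-Wolfe algorithm applied to $\min_{x\in\mathcal{C}}f(x)$ with step-size $\eta_t$ and with the linear minimization oracle satisfying the tie-breaking rule that $p_t=\Phi(z)$ with $z=\min\left(\operatorname{argmin}_{y\in[0,1]}\langle x_t,\Phi(y)\rangle_{\mathcal{H}}\right)$, it holds that $f(x_t)=\frac{1}{24t^2}$ for all $t\in\{1,\ldots,T\}$ such that $t=2^m$ for some $m\in\mathbb{N}$.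
   Context: Here $\mathbb{N}$ includes $0$. The Hilbert space is $$\mathcal{H}=\Big\{x\colon[0,1]\to\mathbb{R}\ \Big|\ x'\in L^2([0,1]),\ x(y)=\sum_{j=1}^\infty(a_j\cos(2\pi jy)+b_j\sin(2\pi jy)),\ a_j,b_j\in\mathbb{R}\Big\}$$ with inner product $\langle w,x\rangle_{\mathcal{H}}=\int_{[0,1]}w'(y)x'(y)\,dy$. It is a reproducing kernel Hilbert space with reproducing kernel $$k(y,z)=\sum_{j=1}^\infty\frac{2}{(2\pi j)^2}\cos(2\pi j(y-z))=\frac12B_2([y-z]),$$ where $[y]=y-\lfloor y\rfloor$ and $B_2(y)=y^2-y+\frac16$. The feature map $\Phi$ satisfies $x(y)=\langle x,\Phi(y)\rangle_{\mathcal{H}}$ for $x\in\mathcal{H}$, $y\in[0,1]$, i.e. $\Phi(y)=k(y,\cdot)$, and $k(y,z)=\langle\Phi(y),\Phi(z)\rangle_{\mathcal{H}}$. Frank-Wolfe algorithm: given $x_0\in\mathcal{C}$, for $t=0,\ldots,T-1$ choose $p_t\in\operatorname{argmin}_{p\in\mathcal{C}}Df(x_t)(p-x_t)$, where $Df(w)(x)=\langle w,x\rangle_{\mathcal{H}}$, and set $x_{t+1}=(1-\eta_t)x_t+\eta_tp_t$. The minimum of $p\mapsto\langle x_t,p\rangle_{\mathcal{H}}$ over $\mathcal{C}$ is attained at points of the form $\Phi(y)$, $y\in[0,1]$. *)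

theory Defs
  imports "HOL-Analysis.Analysis"
begin

definition bernoulli2 :: "real \<Rightarrow> real" where
  "bernoulli2 y = y\<^sup>2 - y + 1 / 6"

lemma dirichlet_kernel:
  "2 * sin (\<theta> / 2) * (1 / 2 + (\<Sum>j=1..n. cos (real j * \<theta>))) = sin ((real n + 1 / 2) * \<theta>)"
proof (induction n)
  case 0
  then show ?case by simp
next
  case (Suc n)
  have "2 * sin (\<theta> / 2) * cos (real (Suc n) * \<theta>)
      = sin ((real (Suc n) + 1 / 2) * \<theta>) - sin ((real n + 1 / 2) * \<theta>)"
  proof -
    have "sin ((real (Suc n) + 1 / 2) * \<theta>) = sin (real (Suc n) * \<theta> + \<theta> / 2)"
      "sin ((real n + 1 / 2) * \<theta>) = sin (real (Suc n) * \<theta> - \<theta> / 2)"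
      by (auto simp: field_simps)
    then show ?thesis by (simp add: sin_add sin_diff)
  qed
  with Suc show ?case by (simp add: algebra_simps)
qed

lemma cos_series_aux:
  fixes a b \<theta> :: real
  assumes ab: "0 < a" "a \<le> pi" "pi \<le> b" "b < 2 * pi" and \<theta>: "\<theta> \<in> {a..b}"
  shows "(\<lambda>n. (\<Sum>j=1..n. cos (real j * \<theta>) / (real j)\<^sup>2) - (\<theta> - pi)\<^sup>2 / 4
            - (\<Sum>j=1..n. cos (real j * pi) / (real j)\<^sup>2)) \<longlonglongrightarrow> 0"
proof -
  define Q where "Q = (\<lambda>t::real. 1 / (2 * sin (t / 2)))"
  define Q' where "Q' = (\<lambda>t::real. - cos (t / 2) / (4 * (sin (t / 2))\<^sup>2))"
  have spos: "sin (t / 2) > 0" if "t \<in> {a..b}" for t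
    using that ab by (intro sin_gt_zero) auto
  have dQ: "(Q has_field_derivative Q' t) (at t within {a..b})" if "t \<in> {a..b}" for t
    unfolding Q_def Q'_def using spos[OF that]
    by (auto intro!: derivative_eq_intros simp: field_simps power2_eq_square)
  have "continuous_on {a..b} Q" "continuous_on {a..b} Q'"
    unfolding Q_def Q'_def by (intro continuous_intros; use spos in force)+
  then have "bounded (Q ` {a..b})" "bounded (Q' ` {a..b})"
    by (auto intro!: compact_imp_bounded compact_continuous_image)
  then obtain C0 C1 where C: "\<And>t. t \<in> {a..b} \<Longrightarrow> \<bar>Q t\<bar> \<le> C0" "\<And>t. t \<in> {a..b} \<Longrightarrow> \<bar>Q' t\<bar> \<le> C1"
    by (force simp: bounded_iff)
  have pi_in: "pi \<in> {a..b}" using ab by auto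
  have C_pos: "0 \<le> C0" "0 \<le> C1" using C[OF pi_in] by linarith+
  define K where "K = C1 * (2 * pi) + C0"
  define H where "H = (\<lambda>n t. \<Sum>j=1..n. sin (real j * t) / real j)"
  define F where "F = (\<lambda>n t. \<Sum>j=1..n. cos (real j * t) / (real j)\<^sup>2)"
  have dist_pi: "\<bar>t - pi\<bar> \<le> 2 * pi" if "t \<in> {a..b}" for t
    using that ab by auto
  have Hb: "\<bar>- H n t + (pi - t) / 2\<bar> \<le> K / (n + 1 / 2)" if t: "t \<in> {a..b}" for n t
  proof -
    define N where "N = real n + 1 / 2"
    have N: "N > 0" by (simp add: N_def)
    define V where "V = (\<lambda>t. - H n t + (pi - t) / 2 - Q t * cos (N * t) / N)"
    have dV: "(V has_field_derivative - Q' s * cos (N * s) / N) (at s within {a..b})"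
      if s: "s \<in> {a..b}" for s
    proof -
      have dH: "(H n has_field_derivative (\<Sum>j=1..n. cos (real j * s))) (at s within {a..b})"
        unfolding H_def by (auto intro!: derivative_eq_intros sum.cong)
      have k: "1 / 2 + (\<Sum>j=1..n. cos (real j * s)) = Q s * sin (N * s)"
        using dirichlet_kernel[of s n] spos[OF s] by (simp add: Q_def N_def field_simps)
      have "(V has_field_derivative
          - (\<Sum>j=1..n. cos (real j * s)) - 1 / 2
           - (Q' s * cos (N * s) - Q s * (sin (N * s) * N)) / N) (at s within {a..b})"
        unfolding V_def using N by (auto intro!: derivative_eq_intros dH dQ s simp: field_simps)
      also have "- (\<Sum>j=1..n. cos (real j * s)) - 1 / 2
           - (Q' s * cos (N * s) - Q s * (sin (N * s) * N)) / N = - Q' s * cos (N * s) / N"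
      proof -
        have "- (\<Sum>j=1..n. cos (real j * s)) - 1 / 2 = - (Q s * sin (N * s))"
          using k by linarith
        then show ?thesis using N by (simp add: diff_divide_distrib)
      qed
      finally show ?thesis .
    qed
    have "norm (V t - V pi) \<le> C1 / N * norm (t - pi)"
    proof (rule field_differentiable_bound[of "{a..b}"])
      show "norm (- Q' z * cos (N * z) / N) \<le> C1 / N" if "z \<in> {a..b}" for z
        using C(2)[OF that] N C_pos abs_cos_le_one[of "N * z"]
          mult_mono[of "\<bar>Q' z\<bar>" C1 "\<bar>cos (N * z)\<bar>" 1]
        by (simp add: abs_mult divide_right_mono)
    qed (use dV t pi_in in auto)
    moreover have "V pi = 0"
    proof -
      have "cos (N * pi) = 0"
        by (simp add: N_def distrib_right cos_add)
      moreover have "H n pi = 0" unfolding H_def by simp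
      ultimately show ?thesis by (simp add: V_def)
    qed
    moreover have "C1 / N * norm (t - pi) \<le> C1 / N * (2 * pi)"
      using dist_pi[OF t] C_pos N by (intro mult_left_mono) auto
    ultimately have 1: "\<bar>V t\<bar> \<le> C1 * (2 * pi) / N" by simp
    have 2: "\<bar>Q t * cos (N * t) / N\<bar> \<le> C0 / N"
      using C(1)[OF t] N C_pos abs_cos_le_one[of "N * t"]
          mult_mono[of "\<bar>Q t\<bar>" C0 "\<bar>cos (N * t)\<bar>" 1]
      by (simp add: abs_mult divide_right_mono)
    have "K / N = C1 * (2 * pi) / N + C0 / N" by (simp add: K_def add_divide_distrib)
    then show ?thesis using 1 2 unfolding V_def N_def[symmetric] by linarith
  qed
  have Fb: "norm ((F n \<theta> - (\<theta> - pi)\<^sup>2 / 4) - (F n pi - (pi - pi)\<^sup>2 / 4)) \<le> K / (n + 1 / 2) * norm (\<theta> - pi)" for n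
  proof (rule field_differentiable_bound[of "{a..b}" "\<lambda>t. F n t - (t - pi)\<^sup>2 / 4" "\<lambda>t. - H n t + (pi - t) / 2"])
    show "((\<lambda>t. F n t - (t - pi)\<^sup>2 / 4) has_field_derivative - H n z + (pi - z) / 2) (at z within {a..b})" for z
    proof -
      have "(F n has_field_derivative (\<Sum>j=1..n. - (sin (real j * z) / real j))) (at z within {a..b})"
        unfolding F_def by (auto intro!: derivative_eq_intros sum.cong simp: power2_eq_square)
      then have dF: "(F n has_field_derivative - H n z) (at z within {a..b})"
        by (simp add: H_def sum_negf)
      show ?thesis by (auto intro!: derivative_eq_intros dF simp: field_simps)
    qed
    show "norm (- H n z + (pi - z) / 2) \<le> K / (n + 1 / 2)" if "z \<in> {a..b}" for z
      using Hb[OF that] by simp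
  qed (use \<theta> pi_in in auto)
  show ?thesis
  proof (rule Lim_null_comparison)
    show "\<forall>\<^sub>F n in sequentially. norm ((\<Sum>j=1..n. cos (real j * \<theta>) / (real j)\<^sup>2) - (\<theta> - pi)\<^sup>2 / 4
            - (\<Sum>j=1..n. cos (real j * pi) / (real j)\<^sup>2)) \<le> K / (n + 1 / 2) * norm (\<theta> - pi)"
      using Fb unfolding F_def by (intro always_eventually allI) simp
    show "(\<lambda>n. K / (real n + 1 / 2) * norm (\<theta> - pi)) \<longlonglongrightarrow> 0"
    proof -
      have "(\<lambda>n. 1 / (real n + 1 / 2)) \<longlonglongrightarrow> 0"
      proof (rule Lim_null_comparison[OF _ tendsto_mult_right_zero[OF LIMSEQ_inverse_real_of_nat, of 2]])
        show "\<forall>\<^sub>F n in sequentially. norm (1 / (real n + 1 / 2)) \<le> 2 * inverse (real (Suc n))"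
          by (intro always_eventually allI) (simp add: field_simps)
      qed
      from tendsto_mult_left[OF this, of "K * norm (\<theta> - pi)"] show ?thesis by (simp add: mult.commute)
    qed
  qed
qed

lemma kernel_series_uniform:
  "uniform_limit UNIV (\<lambda>n t. \<Sum>j=1..n. cos (real j * t) / (real j)\<^sup>2)
     (\<lambda>t. pi\<^sup>2 * bernoulli2 (frac (t / (2 * pi)))) sequentially"
proof -
  define F where "F = (\<lambda>n t. \<Sum>j=1..n. cos (real j * t) / (real j)\<^sup>2)"
  define S where "S = (\<lambda>t. \<Sum>j. cos (real (Suc j) * t) / (real (Suc j))\<^sup>2)"
  have F_alt: "F n t = (\<Sum>j<n. cos (real (Suc j) * t) / (real (Suc j))\<^sup>2)" for n t
    unfolding F_def by (rule sum.reindex_bij_witness[of _ Suc "\<lambda>j. j - 1"]) auto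
  have summ: "summable (\<lambda>j. 1 / (real (Suc j))\<^sup>2)"
    using inverse_squares_sums by (auto simp: sums_iff add.commute)
  have U: "uniform_limit UNIV F S sequentially"
    unfolding F_alt[abs_def] S_def
    by (rule Weierstrass_m_test[OF _ summ]) (auto simp: divide_right_mono)
  then have lim: "(\<lambda>n. F n t) \<longlonglongrightarrow> S t" for t
    by (rule tendsto_uniform_limitI) auto
  have "continuous_on UNIV S"
  proof (rule uniform_limit_theorem[OF _ U])
    show "\<forall>\<^sub>F n in sequentially. continuous_on UNIV (F n)"
      unfolding F_def by (intro always_eventually allI continuous_intros) auto
  qed auto
  then have contS: "continuous_on A S" for A using continuous_on_subset by blast
  have S_int: "S \<theta> - (\<theta> - pi)\<^sup>2 / 4 = S pi" if "0 < \<theta>" "\<theta> < 2 * pi" for \<theta>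
  proof -
    have "(\<lambda>n. F n \<theta> - (\<theta> - pi)\<^sup>2 / 4 - F n pi) \<longlonglongrightarrow> 0"
      unfolding F_def using cos_series_aux[of "min \<theta> pi" "max \<theta> pi" \<theta>] that pi_gt_zero by auto
    moreover have "(\<lambda>n. F n \<theta> - (\<theta> - pi)\<^sup>2 / 4 - F n pi) \<longlonglongrightarrow> S \<theta> - (\<theta> - pi)\<^sup>2 / 4 - S pi"
      by (intro tendsto_intros lim)
    ultimately show ?thesis using LIMSEQ_unique by fastforce
  qed
  have S_cl: "S \<theta> = (\<theta> - pi)\<^sup>2 / 4 + S pi" if "0 \<le> \<theta>" "\<theta> \<le> 2 * pi" for \<theta>
  proof -
    have cl: "closure {0<..<2*pi} = {0..2*pi}" using pi_gt_zero by (simp del: pi_gt_zero)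
    have "S \<theta> - (\<theta> - pi)\<^sup>2 / 4 = S pi"
    proof (rule continuous_constant_on_closure[of "{0<..<2*pi}" "\<lambda>\<theta>. S \<theta> - (\<theta> - pi)\<^sup>2 / 4"])
      show "continuous_on (closure {0<..<2 * pi}) (\<lambda>\<theta>. S \<theta> - (\<theta> - pi)\<^sup>2 / 4)"
        by (intro continuous_intros contS) auto
    qed (use S_int that cl in auto)
    then show ?thesis by simp
  qed
  have "S 0 = pi\<^sup>2 / 6"
    using inverse_squares_sums unfolding S_def by (simp add: sums_iff add.commute)
  with S_cl[of 0] have Spi: "S pi = - pi\<^sup>2 / 12" by simp
  have per: "S (t + 2 * pi * of_int k) = S t" for t k
  proof -
    have "cos (real (Suc j) * (t + 2 * pi * of_int k)) = cos (real (Suc j) * t)" for j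
    proof -
      have "real (Suc j) * (t + 2 * pi * of_int k) = real (Suc j) * t + 2 * pi * of_int (int (Suc j) * k)"
        by (simp add: algebra_simps)
      then show ?thesis by (simp only: cos_add cos_int_2pin sin_int_2pin)
    qed
    then show ?thesis by (simp add: S_def)
  qed
  have "S t = pi\<^sup>2 * bernoulli2 (frac (t / (2 * pi)))" for t
  proof -
    define u where "u = frac (t / (2 * pi))"
    have u: "0 \<le> u" "u < 1" by (auto simp: u_def frac_lt_1)
    have "t = 2 * pi * u + 2 * pi * of_int \<lfloor>t / (2 * pi)\<rfloor>"
      by (simp add: u_def frac_def field_simps)
    then have "S t = S (2 * pi * u)" using per by metis
    also have "\<dots> = (2 * pi * u - pi)\<^sup>2 / 4 + S pi"
      using u by (intro S_cl) auto
    also have "\<dots> = pi\<^sup>2 * bernoulli2 u"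
      by (simp add: Spi bernoulli2_def power2_eq_square field_simps)
    finally show ?thesis by (simp add: u_def)
  qed
  then have "S = (\<lambda>t. pi\<^sup>2 * bernoulli2 (frac (t / (2 * pi))))" by (rule ext)
  with U show ?thesis by (simp add: F_def[abs_def])
qed


text \<open>
  The condition \<open>x' \<in> L\<^sup>2([0,1])\<close> is read as: \<open>x\<close> is absolutely continuous on \<open>[0,1]\<close>, i.e. an
  indefinite integral of its derivative, which is square-integrable. Mere almost-everywhere
  differentiability would not do, since Cantor-type functions would then have norm 0.
\<close>

definition L2_derivative :: "(real \<Rightarrow> real) \<Rightarrow> (real \<Rightarrow> real) \<Rightarrow> bool" where
  "L2_derivative x g \<longleftrightarrow>
     g \<in> borel_measurable borel \<and> set_integrable lborel {0..1} (\<lambda>t. (g t)\<^sup>2) \<and>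
     (\<forall>y\<in>{0..1}. x y = x 0 + (LINT t:{0..y}|lborel. g t))"

definition fourier_sum :: "(nat \<Rightarrow> real) \<Rightarrow> (nat \<Rightarrow> real) \<Rightarrow> nat \<Rightarrow> real \<Rightarrow> real" where
  "fourier_sum a b n y =
     (\<Sum>j=1..n. a j * cos (2 * pi * real j * y) + b j * sin (2 * pi * real j * y))"

lemma L2_derivativeD:
  assumes "L2_derivative x g"
  shows "g \<in> borel_measurable borel" "set_integrable lborel {0..1} (\<lambda>t. (g t)\<^sup>2)"
    and "y \<in> {0..1} \<Longrightarrow> x y = x 0 + (LINT t:{0..y}|lborel. g t)"
  using assms unfolding L2_derivative_def by blast+

lemma set_integrable_prod_L2:
  fixes g h :: "real \<Rightarrow> real"
  assumes [measurable]: "g \<in> borel_measurable borel" "h \<in> borel_measurable borel" "A \<in> sets borel"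
    and g: "set_integrable lborel A (\<lambda>t. (g t)\<^sup>2)"
    and h: "set_integrable lborel A (\<lambda>t. (h t)\<^sup>2)"
  shows "set_integrable lborel A (\<lambda>t. g t * h t)"
proof (rule set_integrable_bound[OF set_integral_add(1)[OF g h]])
  show "set_borel_measurable lborel A (\<lambda>t. g t * h t)"
    unfolding set_borel_measurable_def by measurable
  have "\<bar>a * b\<bar> \<le> a\<^sup>2 + b\<^sup>2" for a b :: real
  proof -
    have "0 \<le> (\<bar>a\<bar> - \<bar>b\<bar>)\<^sup>2" "0 \<le> \<bar>a\<bar> * \<bar>b\<bar>" by auto
    then show ?thesis unfolding abs_mult power2_diff power2_abs by linarith
  qed
  then show "AE t in lborel. t \<in> A \<longrightarrow> norm (g t * h t) \<le> norm ((g t)\<^sup>2 + (h t)\<^sup>2)"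
    by (intro AE_I2) (metis abs_ge_self order_trans real_norm_def)
qed

lemma L2_derivative_integrable:
  assumes "L2_derivative x g" "y \<le> 1"
  shows "set_integrable lborel {0..y} g"
proof -
  have "set_integrable lborel {0..1} (\<lambda>t. 1 * g t)"
    using L2_derivativeD[OF assms(1)] by (intro set_integrable_prod_L2) (auto simp: set_integrable_def)
  then show ?thesis
    using \<open>y \<le> 1\<close> by (auto intro: set_integrable_subset)
qed

lemma integral_Icc_0_imp_AE_0:
  fixes f :: "real \<Rightarrow> real"
  assumes f: "set_integrable lborel {0..1} f"
    and 0: "\<And>y. y \<in> {0..1} \<Longrightarrow> (LINT t:{0..y}|lborel. f t) = 0"
  shows "AE t in lborel. t \<in> {0..1} \<longrightarrow> f t = 0"
proof -
  define F where "F = (\<lambda>t. indicator {0..1} t *\<^sub>R f t)"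
  have F: "integrable lborel F" using f by (simp add: F_def set_integrable_def)
  have Fs: "set_integrable lborel A F" if "A \<in> sets borel" for A
    unfolding set_integrable_def by (rule integrable_mult_indicator[OF _ F]) (use that in auto)
  have Iic: "(LINT t:{..a}|lborel. F t) = 0" for a
  proof (cases "a < 0")
    case True
    then have "(LINT t:{..a}|lborel. F t) = (LINT t:{..a}|lborel. 0)"
      by (intro set_lebesgue_integral_cong) (auto simp: F_def)
    then show ?thesis by simp
  next
    case False
    have "(LINT t:{..a}|lborel. F t) = (LINT t:{0..min a 1}|lborel. f t)"
      unfolding set_lebesgue_integral_def F_def
      by (intro Bochner_Integration.integral_cong) (auto simp: indicator_def)
    with False 0[of "min a 1"] show ?thesis by auto
  qed
  have total: "(LINT t|lborel. F t) = 0"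
    using 0[of 1] by (simp add: F_def set_lebesgue_integral_def)
  have "(LINT t:A|lborel. F t) = 0" if "A \<in> sets lborel" for A
  proof -
    have "Int_stable (range (\<lambda>a::real. {..a}))"
      by (auto simp: Int_stable_def)
    moreover have "range (\<lambda>a::real. {..a}) \<subseteq> Pow UNIV" by simp
    moreover have "A \<in> sigma_sets UNIV (range (\<lambda>a::real. {..a}))"
      using that by (simp add: borel_eq_atMost)
    ultimately show ?thesis
    proof (induction rule: sigma_sets_induct_disjoint)
      case (basic A) then show ?case using Iic by auto
    next
      case empty then show ?case by (simp add: set_lebesgue_integral_def)
    next
      case (compl A)
      have A: "A \<in> sets borel" using compl(1) by (simp add: borel_eq_atMost)
      have "(LINT t:A \<union> (UNIV - A)|lborel. F t)
          = (LINT t:A|lborel. F t) + (LINT t:UNIV - A|lborel. F t)"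
        using A by (intro set_integral_Un Fs) auto
      moreover have "(LINT t:A \<union> (UNIV - A)|lborel. F t) = 0"
        using total by (simp add: set_lebesgue_integral_def)
      ultimately show ?case using compl by simp
    next
      case (union A)
      have A: "A i \<in> sets borel" for i using union(2) by (auto simp: borel_eq_atMost)
      have "(LINT t:(\<Union>i. A i)|lborel. F t) = (\<Sum>i. LINT t:A i|lborel. F t)"
        using A union(1) by (intro lebesgue_integral_countable_add Fs) (auto simp: disjoint_family_on_def)
      then show ?case using union by simp
    qed
  qed
  then have "AE t in lborel. F t = 0" by (rule sigma_finite_measure.density_zero[OF sigma_finite_lborel F])
  then show ?thesis by eventually_elim (auto simp: F_def)
qed

lemma L2_derivative_unique:
  assumes g: "L2_derivative x g" and h: "L2_derivative x h"
  shows "AE t in lborel. t \<in> {0..1} \<longrightarrow> g t = h t"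
proof -
  have "AE t in lborel. t \<in> {0..1} \<longrightarrow> g t - h t = 0"
  proof (rule integral_Icc_0_imp_AE_0)
    show "set_integrable lborel {0..1} (\<lambda>t. g t - h t)"
      using g h by (intro set_integral_diff L2_derivative_integrable) auto
    show "(LINT t:{0..y}|lborel. g t - h t) = 0" if "y \<in> {0..1}" for y
    proof -
      have "(LINT t:{0..y}|lborel. g t - h t) = (LINT t:{0..y}|lborel. g t) - (LINT t:{0..y}|lborel. h t)"
        using g h that by (intro set_integral_diff L2_derivative_integrable) auto
      then show ?thesis using L2_derivativeD(3)[OF g that] L2_derivativeD(3)[OF h that] by linarith
    qed
  qed
  then show ?thesis by simp
qed

lemma L2_derivative_add:
  assumes "L2_derivative x g" "L2_derivative y h"
  shows "L2_derivative (\<lambda>t. x t + y t) (\<lambda>t. g t + h t)"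
proof -
  have [measurable]: "g \<in> borel_measurable borel" "h \<in> borel_measurable borel"
    using assms by (auto intro: L2_derivativeD(1))
  have "set_integrable lborel {0..1} (\<lambda>t. (g t)\<^sup>2 + (h t)\<^sup>2 + 2 * (g t * h t))"
    using assms by (intro set_integral_add set_integrable_mult_right set_integrable_prod_L2)
      (auto intro: L2_derivativeD(1,2))
  also have "(\<lambda>t. (g t)\<^sup>2 + (h t)\<^sup>2 + 2 * (g t * h t)) = (\<lambda>t. (g t + h t)\<^sup>2)"
    by (simp add: power2_sum mult.assoc)
  finally have sq: "set_integrable lborel {0..1} (\<lambda>t. (g t + h t)\<^sup>2)" .
  have "x s + y s = x 0 + y 0 + (LINT t:{0..s}|lborel. g t + h t)" if "s \<in> {0..1}" for s
  proof -
    have "(LINT t:{0..s}|lborel. g t + h t) = (LINT t:{0..s}|lborel. g t) + (LINT t:{0..s}|lborel. h t)"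
      using assms that by (intro set_integral_add L2_derivative_integrable) auto
    then show ?thesis
      using L2_derivativeD(3)[OF assms(1) that] L2_derivativeD(3)[OF assms(2) that] by linarith
  qed
  moreover have "(\<lambda>t. g t + h t) \<in> borel_measurable borel" by measurable
  ultimately show ?thesis using sq unfolding L2_derivative_def by blast
qed

lemma L2_derivative_scale:
  assumes "L2_derivative x g"
  shows "L2_derivative (\<lambda>t. r * x t) (\<lambda>t. r * g t)"
proof -
  have "r * x s = r * x 0 + (LINT t:{0..s}|lborel. r * g t)" if "s \<in> {0..1}" for s
  proof -
    have "x s = x 0 + (LINT t:{0..s}|lborel. g t)"
      using assms that unfolding L2_derivative_def by blast
    then show ?thesis unfolding set_integral_mult_right by (metis distrib_left)
  qed
  moreover have "(\<lambda>t. r * g t) \<in> borel_measurable borel"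
    using assms unfolding L2_derivative_def by (intro borel_measurable_times) auto
  moreover have "set_integrable lborel {0..1} (\<lambda>t. (r * g t)\<^sup>2)"
    using assms unfolding L2_derivative_def power_mult_distrib by (intro set_integrable_mult_right) auto
  ultimately show ?thesis unfolding L2_derivative_def by blast
qed

lemma fourier_sum_add: "fourier_sum a b n y + fourier_sum a' b' n y
    = fourier_sum (\<lambda>j. a j + a' j) (\<lambda>j. b j + b' j) n y"
  by (simp add: fourier_sum_def algebra_simps flip: sum.distrib)

lemma fourier_sum_scale: "r * fourier_sum a b n y = fourier_sum (\<lambda>j. r * a j) (\<lambda>j. r * b j) n y"
  by (simp add: fourier_sum_def sum_distrib_left algebra_simps)

lemma fourier_limit_periodic:
  assumes "uniform_limit UNIV (fourier_sum a b) x sequentially"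
  shows "x (y + of_int k) = x y"
proof -
  have eq: "fourier_sum a b n (y + of_int k) = fourier_sum a b n y" for n
  proof -
    have "2 * pi * real j * (y + of_int k) = 2 * pi * real j * y + 2 * pi * of_int (int j * k)" for j
      by (simp add: algebra_simps)
    then show ?thesis
      unfolding fourier_sum_def by (simp only: cos_add sin_add cos_int_2pin sin_int_2pin) simp
  qed
  have "(\<lambda>n. fourier_sum a b n (y + of_int k)) \<longlonglongrightarrow> x (y + of_int k)"
    "(\<lambda>n. fourier_sum a b n y) \<longlonglongrightarrow> x y"
    using assms by (auto intro: tendsto_uniform_limitI)
  then show ?thesis unfolding eq using LIMSEQ_unique by blast
qed

lemma fourier_limit_continuous:
  assumes "uniform_limit UNIV (fourier_sum a b) x sequentially"
  shows "continuous_on A x"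
proof -
  have "continuous_on UNIV x"
  proof (rule uniform_limit_theorem[OF _ assms])
    show "\<forall>\<^sub>F n in sequentially. continuous_on UNIV (fourier_sum a b n)"
      unfolding fourier_sum_def by (intro always_eventually allI continuous_intros)
  qed auto
  then show ?thesis using continuous_on_subset by blast
qed

lemma fourier_limit_mean:
  assumes "uniform_limit UNIV (fourier_sum a b) x sequentially"
  shows "(x has_integral 0) {0..1}"
proof -
  have u: "uniform_limit {0..1} (fourier_sum a b) x sequentially"
    using assms by (rule uniform_limit_on_subset) auto
  have c: "continuous_on {0..1} (fourier_sum a b n)" for n
    unfolding fourier_sum_def by (intro continuous_intros)
  obtain I J where IJ: "\<And>n. (fourier_sum a b n has_integral I n) {0..1}"
    "(x has_integral J) {0..1}" "I \<longlonglongrightarrow> J"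
    using uniform_limit_integral[OF u c] by auto
  have "(fourier_sum a b n has_integral (\<Sum>j=1..n. a j * 0 + b j * 0)) {0..1}" for n
    unfolding fourier_sum_def[abs_def]
  proof (intro has_integral_sum has_integral_add has_integral_mult_right)
    fix j assume j: "j \<in> {1..n}"
    define w where "w = 2 * pi * real j"
    have w: "w > 0" "sin w = 0" "cos w = 1"
      using j sin_int_2pin[of "int j"] cos_int_2pin[of "int j"] by (auto simp: w_def)
    have "((\<lambda>y. cos (w * y)) has_integral (sin (w * 1) / w - sin (w * 0) / w)) {0..1}"
      using w by (intro fundamental_theorem_of_calculus)
        (auto intro!: derivative_eq_intros simp flip: has_real_derivative_iff_has_vector_derivative)
    then show "((\<lambda>y. cos (2 * pi * real j * y)) has_integral 0) {0..1}"
      using w by (simp add: w_def)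
    have "((\<lambda>y. sin (w * y)) has_integral (- cos (w * 1) / w - - cos (w * 0) / w)) {0..1}"
      using w by (intro fundamental_theorem_of_calculus)
        (auto intro!: derivative_eq_intros simp flip: has_real_derivative_iff_has_vector_derivative)
    then show "((\<lambda>y. sin (2 * pi * real j * y)) has_integral 0) {0..1}"
      using w by (simp add: w_def)
  qed auto
  from has_integral_unique[OF IJ(1) this] have "I = (\<lambda>_. 0)" by (simp add: fun_eq_iff)
  then have "J = 0" using IJ(3) by (simp add: LIMSEQ_const_iff)
  then show ?thesis using IJ(2) by simp
qed

text \<open>
  The Hilbert space \<open>H\<close>. Functions on \<open>[0,1]\<close> that are sums of trigonometric series are represented
  by their 1-periodic extensions, which the series itself provides. The sum is required
  to converge uniformly; the Fourier series of a function with derivative in \<open>L\<^sup>2\<close> always does.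
\<close>

typedef periodic_sobolev =
  "{x. (\<exists>a b. uniform_limit UNIV (fourier_sum a b) x sequentially) \<and> (\<exists>g. L2_derivative x g)}"
  morphisms fun_of Abs_periodic_sobolev
proof
  have "fourier_sum (\<lambda>_. 0) (\<lambda>_. 0) = (\<lambda>_ _. 0)" by (simp add: fourier_sum_def fun_eq_iff)
  then have "uniform_limit UNIV (fourier_sum (\<lambda>_. 0) (\<lambda>_. 0)) (\<lambda>_. 0) sequentially"
    by (simp add: uniform_limit_const)
  moreover have "L2_derivative (\<lambda>_. 0) (\<lambda>_. 0)" by (simp add: L2_derivative_def set_integrable_def)
  ultimately show "(\<lambda>_. 0) \<in> {x. (\<exists>a b. uniform_limit UNIV (fourier_sum a b) x sequentially) \<and> (\<exists>g. L2_derivative x g)}"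
    by blast
qed

setup_lifting type_definition_periodic_sobolev

text \<open>
  The derivative is determined only up to null sets (\<open>L2_derivative_unique\<close>), so the choice made
  here does not affect integrals: see \<open>inner_periodic_sobolev_eq\<close>.
\<close>

definition weak_derivative :: "periodic_sobolev \<Rightarrow> real \<Rightarrow> real" where
  "weak_derivative x = (SOME g. L2_derivative (fun_of x) g)"

lemma L2_derivative_weak_derivative: "L2_derivative (fun_of x) (weak_derivative x)"
proof -
  have "\<exists>g. L2_derivative (fun_of x) g" using fun_of[of x] by blast
  then show ?thesis unfolding weak_derivative_def by (rule someI_ex)
qed

lemma borel_measurable_weak_derivative [measurable]: "weak_derivative x \<in> borel_measurable borel"
  by (rule L2_derivativeD(1)[OF L2_derivative_weak_derivative])

lemma sq_integrable_weak_derivative: "set_integrable lborel {0..1} (\<lambda>t. (weak_derivative x t)\<^sup>2)"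
  by (rule L2_derivativeD(2)[OF L2_derivative_weak_derivative])

lemma fun_of_fourier:
  obtains a b where "uniform_limit UNIV (fourier_sum a b) (fun_of x) sequentially"
  using fun_of[of x] unfolding mem_Collect_eq by (elim conjE exE)

lemma weak_derivative_AE:
  assumes "L2_derivative (fun_of x) g"
  shows "AE t in lborel. t \<in> {0..1} \<longrightarrow> weak_derivative x t = g t"
  by (rule L2_derivative_unique[OF L2_derivative_weak_derivative assms])

instantiation periodic_sobolev :: real_inner
begin

lift_definition zero_periodic_sobolev :: periodic_sobolev is "\<lambda>_. 0"
proof -
  have "fourier_sum (\<lambda>_. 0) (\<lambda>_. 0) = (\<lambda>_ _. 0)" by (simp add: fourier_sum_def fun_eq_iff)
  then have "uniform_limit UNIV (fourier_sum (\<lambda>_. 0) (\<lambda>_. 0)) (\<lambda>_. 0) sequentially"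
    by (simp add: uniform_limit_const)
  moreover have "L2_derivative (\<lambda>_. 0) (\<lambda>_. 0)" by (simp add: L2_derivative_def set_integrable_def)
  ultimately show "(\<exists>a b. uniform_limit UNIV (fourier_sum a b) (\<lambda>_. 0) sequentially) \<and> (\<exists>g. L2_derivative (\<lambda>_. 0) g)"
    by blast
qed

lift_definition plus_periodic_sobolev :: "periodic_sobolev \<Rightarrow> periodic_sobolev \<Rightarrow> periodic_sobolev"
  is "\<lambda>x y t. x t + y t"
proof (elim conjE exE, intro conjI exI)
  fix x y :: "real \<Rightarrow> real" and a b a' b' :: "nat \<Rightarrow> real"
  assume "uniform_limit UNIV (fourier_sum a b) x sequentially"
    "uniform_limit UNIV (fourier_sum a' b') y sequentially"
  from uniform_limit_add[OF this]
  show "uniform_limit UNIV (fourier_sum (\<lambda>j. a j + a' j) (\<lambda>j. b j + b' j)) (\<lambda>t. x t + y t) sequentially"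
    by (simp add: fourier_sum_add)
qed (rule L2_derivative_add)

lift_definition scaleR_periodic_sobolev :: "real \<Rightarrow> periodic_sobolev \<Rightarrow> periodic_sobolev"
  is "\<lambda>r x t. r * x t"
proof (elim conjE exE, intro conjI exI)
  fix r :: real and x :: "real \<Rightarrow> real" and a b :: "nat \<Rightarrow> real"
  assume "uniform_limit UNIV (fourier_sum a b) x sequentially"
  from bounded_linear.uniform_limit[OF bounded_linear_mult_right this, of r]
  show "uniform_limit UNIV (fourier_sum (\<lambda>j. r * a j) (\<lambda>j. r * b j)) (\<lambda>t. r * x t) sequentially"
    by (simp add: fourier_sum_scale)
qed (rule L2_derivative_scale)

definition uminus_periodic_sobolev :: "periodic_sobolev \<Rightarrow> periodic_sobolev" where
  "- x = (-1) *\<^sub>R (x::periodic_sobolev)"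

definition minus_periodic_sobolev :: "periodic_sobolev \<Rightarrow> periodic_sobolev \<Rightarrow> periodic_sobolev" where
  "x - y = x + - (y::periodic_sobolev)"

definition inner_periodic_sobolev :: "periodic_sobolev \<Rightarrow> periodic_sobolev \<Rightarrow> real" where
  "inner w x = (LINT y:{0..1}|lborel. weak_derivative w y * weak_derivative x y)"

definition norm_periodic_sobolev :: "periodic_sobolev \<Rightarrow> real" where
  "norm x = sqrt (inner x (x::periodic_sobolev))"

definition sgn_periodic_sobolev :: "periodic_sobolev \<Rightarrow> periodic_sobolev" where
  "sgn x = scaleR (inverse (norm x)) (x::periodic_sobolev)"

definition dist_periodic_sobolev :: "periodic_sobolev \<Rightarrow> periodic_sobolev \<Rightarrow> real" where
  "dist x y = norm (x - (y::periodic_sobolev))"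

definition uniformity_periodic_sobolev :: "(periodic_sobolev \<times> periodic_sobolev) filter" where
  "uniformity = (INF e\<in>{0 <..}. principal {(x, y). dist x (y::periodic_sobolev) < e})"

definition open_periodic_sobolev :: "periodic_sobolev set \<Rightarrow> bool" where
  "open U \<longleftrightarrow> (\<forall>x\<in>U. \<forall>\<^sub>F (x', y::periodic_sobolev) in uniformity. x' = x \<longrightarrow> y \<in> U)"

lemma inner_periodic_sobolev_eq:
  assumes "L2_derivative (fun_of w) g" "L2_derivative (fun_of x) h"
  shows "inner w x = (LINT y:{0..1}|lborel. g y * h y)"
  unfolding inner_periodic_sobolev_def
proof (rule set_lebesgue_integral_cong_AE)
  have [measurable]: "g \<in> borel_measurable borel" "h \<in> borel_measurable borel"
    using assms by (auto intro: L2_derivativeD(1))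
  show "(\<lambda>y. g y * h y) \<in> borel_measurable lborel" by measurable
  show "AE y\<in>{0..1} in lborel. weak_derivative w y * weak_derivative x y = g y * h y"
    using weak_derivative_AE[OF assms(1)] weak_derivative_AE[OF assms(2)]
    by eventually_elim auto
  show "(\<lambda>y. weak_derivative w y * weak_derivative x y) \<in> borel_measurable lborel" by measurable
qed simp

instance
proof
  fix x y z :: periodic_sobolev and r s :: real
  show "x + y + z = x + (y + z)" by transfer (auto simp: algebra_simps)
  show "x + y = y + x" by transfer (auto simp: algebra_simps)
  show "0 + x = x" by transfer auto
  show "- x + x = 0" unfolding uminus_periodic_sobolev_def by transfer auto
  show "x - y = x + - y" by (rule minus_periodic_sobolev_def)
  show "r *\<^sub>R (x + y) = r *\<^sub>R x + r *\<^sub>R y" by transfer (auto simp: algebra_simps)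
  show "(r + s) *\<^sub>R x = r *\<^sub>R x + s *\<^sub>R x" by transfer (auto simp: algebra_simps)
  show "r *\<^sub>R s *\<^sub>R x = (r * s) *\<^sub>R x" by transfer (auto simp: algebra_simps)
  show "1 *\<^sub>R x = x" by transfer auto
  show "dist x y = norm (x - y)" by (rule dist_periodic_sobolev_def)
  show "sgn x = scaleR (inverse (norm x)) x" by (rule sgn_periodic_sobolev_def)
  show "uniformity = (INF e\<in>{0 <..}. principal {(x, y). dist x (y::periodic_sobolev) < e})"
    by (rule uniformity_periodic_sobolev_def)
  show "open U \<longleftrightarrow> (\<forall>x\<in>U. \<forall>\<^sub>F (x', y) in uniformity. x' = x \<longrightarrow> y \<in> U)" for U :: "periodic_sobolev set"
    by (rule open_periodic_sobolev_def)
  show "norm x = sqrt (inner x x)" by (rule norm_periodic_sobolev_def)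
  show "inner x y = inner y x" by (simp add: inner_periodic_sobolev_def mult.commute)
  note D = L2_derivative_weak_derivative
  have int: "set_integrable lborel {0..1} (\<lambda>t. weak_derivative x t * weak_derivative y t)" for x y
    by (intro set_integrable_prod_L2 sq_integrable_weak_derivative) auto
  have "L2_derivative (fun_of (x + y)) (\<lambda>t. weak_derivative x t + weak_derivative y t)"
    using L2_derivative_add[OF D D] by (simp add: plus_periodic_sobolev.rep_eq)
  from inner_periodic_sobolev_eq[OF this D]
  show "inner (x + y) z = inner x z + inner y z"
    by (simp add: distrib_right set_integral_add(2)[OF int int] inner_periodic_sobolev_def)
  have "L2_derivative (fun_of (r *\<^sub>R x)) (\<lambda>t. r * weak_derivative x t)"
    using L2_derivative_scale[OF D] by (simp add: scaleR_periodic_sobolev.rep_eq)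
  from inner_periodic_sobolev_eq[OF this D]
  show "inner (r *\<^sub>R x) y = r * inner x y"
    by (simp add: mult.assoc inner_periodic_sobolev_def)
  show nn: "0 \<le> inner x x"
    unfolding inner_periodic_sobolev_def set_lebesgue_integral_def
    by (intro Bochner_Integration.integral_nonneg) auto
  show "inner x x = 0 \<longleftrightarrow> x = 0"
  proof
    assume "inner x x = 0"
    then have "AE t in lborel. indicator {0..1} t *\<^sub>R (weak_derivative x t * weak_derivative x t) = 0"
      unfolding inner_periodic_sobolev_def set_lebesgue_integral_def
      using int[of x x] unfolding set_integrable_def
      by (subst (asm) integral_nonneg_eq_0_iff_AE) auto
    then have ae: "AE t in lborel. t \<in> {0..1} \<longrightarrow> weak_derivative x t = 0"
      by eventually_elim auto
    have const: "fun_of x s = fun_of x 0" if s: "s \<in> {0..1}" for s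
    proof -
      have "(LINT t:{0..s}|lborel. weak_derivative x t) = (LINT t:{0..s}|lborel. 0)"
      proof (rule set_lebesgue_integral_cong_AE)
        show "AE t\<in>{0..s} in lborel. weak_derivative x t = 0"
          using ae by eventually_elim (use s in auto)
      qed auto
      then show ?thesis using L2_derivativeD(3)[OF D[of x] s] by simp
    qed
    obtain a b where ab: "uniform_limit UNIV (fourier_sum a b) (fun_of x) sequentially"
      by (rule fun_of_fourier)
    have "((\<lambda>_. fun_of x 0) has_integral 0) {0..1::real}"
      by (rule has_integral_eq[where f = "fun_of x" and g = "\<lambda>_. fun_of x 0"])
        (erule const, rule fourier_limit_mean[OF ab])
    then have 00: "fun_of x 0 = 0"
      using has_integral_unique[OF has_integral_const_real[of "fun_of x 0" 0 1]] by simp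
    have "fun_of x s = 0" for s
    proof -
      have "fun_of x s = fun_of x (frac s + of_int \<lfloor>s\<rfloor>)" by (simp add: frac_def)
      also have "\<dots> = fun_of x (frac s)" by (rule fourier_limit_periodic[OF ab])
      also have "\<dots> = 0" using const[of "frac s"] 00 by (simp add: frac_lt_1 less_imp_le)
      finally show ?thesis .
    qed
    then show "x = 0" by (auto simp: fun_of_inject[symmetric] zero_periodic_sobolev.rep_eq fun_eq_iff)
  next
    assume "x = 0"
    moreover have "L2_derivative (fun_of 0) (\<lambda>_. 0)"
      by (simp add: L2_derivative_def set_integrable_def zero_periodic_sobolev.rep_eq)
    from inner_periodic_sobolev_eq[OF this this] have "inner 0 (0::periodic_sobolev) = 0" by simp
    ultimately show "inner x x = 0" by simp
  qed
qed

end

definition bernoulli_kernel :: "real \<Rightarrow> real \<Rightarrow> real" where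
  "bernoulli_kernel y z = 1 / 2 * bernoulli2 (frac (y - z))"

lemma bernoulli_kernel_fourier:
  "uniform_limit UNIV
     (fourier_sum (\<lambda>j. 2 / (2 * pi * real j)\<^sup>2 * cos (2 * pi * real j * y))
                  (\<lambda>j. 2 / (2 * pi * real j)\<^sup>2 * sin (2 * pi * real j * y)))
     (bernoulli_kernel y) sequentially"
proof -
  have eq: "fourier_sum (\<lambda>j. 2 / (2 * pi * real j)\<^sup>2 * cos (2 * pi * real j * y))
                  (\<lambda>j. 2 / (2 * pi * real j)\<^sup>2 * sin (2 * pi * real j * y)) n z
      = 1 / (2 * pi\<^sup>2) * (\<Sum>j=1..n. cos (real j * (2 * pi * (y - z))) / (real j)\<^sup>2)" for n z
    unfolding fourier_sum_def sum_distrib_left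
  proof (rule sum.cong[OF refl])
    fix j assume "j \<in> {1..n}"
    have "real j * (2 * pi * (y - z)) = 2 * pi * real j * y - 2 * pi * real j * z"
      by (simp add: algebra_simps)
    then show "2 / (2 * pi * real j)\<^sup>2 * cos (2 * pi * real j * y) * cos (2 * pi * real j * z)
        + 2 / (2 * pi * real j)\<^sup>2 * sin (2 * pi * real j * y) * sin (2 * pi * real j * z)
        = 1 / (2 * pi\<^sup>2) * (cos (real j * (2 * pi * (y - z))) / (real j)\<^sup>2)"
      by (simp add: cos_diff power2_eq_square field_simps add_divide_distrib)
  qed
  have "uniform_limit UNIV (\<lambda>n z. \<Sum>j=1..n. cos (real j * (2 * pi * (y - z))) / (real j)\<^sup>2)
     (\<lambda>z. pi\<^sup>2 * bernoulli2 (frac (y - z))) sequentially"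
    unfolding uniform_limit_iff
  proof (intro allI impI)
    fix e :: real assume "e > 0"
    with kernel_series_uniform show "\<forall>\<^sub>F n in sequentially. \<forall>z\<in>UNIV.
        dist (\<Sum>j=1..n. cos (real j * (2 * pi * (y - z))) / (real j)\<^sup>2) (pi\<^sup>2 * bernoulli2 (frac (y - z))) < e"
      unfolding uniform_limit_iff
      apply (elim allE[of _ e] impE)
       apply assumption
      apply (erule eventually_mono)
      subgoal premises p for n
        using p by (auto dest: spec[of _ "2 * pi * (y - _)"])
      done
  qed
  from bounded_linear.uniform_limit[OF bounded_linear_mult_right this, of "1 / (2 * pi\<^sup>2)"]
  moreover have "bernoulli_kernel y = (\<lambda>z. 1 / (2 * pi\<^sup>2) * (pi\<^sup>2 * bernoulli2 (frac (y - z))))"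
    by (simp add: bernoulli_kernel_def fun_eq_iff)
  ultimately show ?thesis by (simp only: eq[abs_def])
qed

lemma bernoulli_kernel_L2_derivative:
  "L2_derivative (bernoulli_kernel y) (\<lambda>z. 1 / 2 - frac (y - z))"
proof -
  define g where "g = (\<lambda>z. 1 / 2 - frac (y - z))"
  have [measurable]: "g \<in> borel_measurable borel" unfolding g_def frac_def by measurable
  have g_bd: "\<bar>g z\<bar> \<le> 1" for z
    unfolding g_def using frac_ge_0[of "y - z"] frac_lt_1[of "y - z"] by linarith
  have bdd: "set_integrable lborel A h"
    if "h \<in> borel_measurable borel" "\<And>z. \<bar>h z\<bar> \<le> (1::real)" "A = {0..s}" for h :: "real \<Rightarrow> real" and A s
  proof -
    have "set_integrable lborel A (\<lambda>_. 1::real)"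
      unfolding \<open>A = {0..s}\<close> by (intro borel_integrable_atLeastAtMost' continuous_intros)
    then show ?thesis
      by (rule set_integrable_bound) (use that in \<open>auto simp: set_borel_measurable_def\<close>)
  qed
  have sq: "set_integrable lborel {0..1} (\<lambda>t. (g t)\<^sup>2)"
    using g_bd by (intro bdd) (auto simp: abs_square_le_1 simp flip: abs_le_square_iff)
  have "bernoulli_kernel y s = bernoulli_kernel y 0 + (LINT t:{0..s}|lborel. g t)" if s: "s \<in> {0..1}" for s
  proof -
    define S where "S = (\<lambda>k::int. y - of_int k) ` {\<lfloor>y - 1\<rfloor>..\<lceil>y\<rceil>}"
    have "(g has_integral (bernoulli_kernel y s - bernoulli_kernel y 0)) {0..s}"
    proof (rule fundamental_theorem_of_calculus_strong)
      show "finite S" by (simp add: S_def)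
      show "continuous_on {0..s} (bernoulli_kernel y)"
        by (rule fourier_limit_continuous[OF bernoulli_kernel_fourier])
      show "(bernoulli_kernel y has_vector_derivative g z) (at z)" if z: "z \<in> {0..s} - S" for z
      proof -
        have ni: "y - z \<notin> \<int>"
        proof
          assume "y - z \<in> \<int>"
          then obtain k where k: "y - z = of_int k" by (auto elim: Ints_cases)
          then have "of_int k \<le> y" "y - 1 \<le> of_int k" using z s by auto
          then have "k \<le> \<lceil>y\<rceil>" "\<lfloor>y - 1\<rfloor> \<le> k" by linarith+
          then have "z \<in> S" using k unfolding S_def by (intro image_eqI[of _ _ k]) auto
          then show False using z by simp
        qed
        have "(frac has_real_derivative 1) (at (y - z))"
        proof -
          define m where "m = \<lfloor>y - z\<rfloor>"
          have "((\<lambda>u. u - of_int m) has_real_derivative 1) (at (y - z))"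
            by (auto intro!: derivative_eq_intros)
          then show ?thesis
          proof (rule has_field_derivative_transform_within_open)
            show "open {real_of_int m<..<real_of_int m + 1}" by simp
            have "of_int m \<noteq> y - z" using ni by (metis Ints_of_int)
            then show "y - z \<in> {real_of_int m<..<real_of_int m + 1}"
              using floor_correct[of "y - z"] unfolding m_def[symmetric] greaterThanLessThan_iff by linarith
            show "u - of_int m = frac u" if "u \<in> {real_of_int m<..<real_of_int m + 1}" for u
            proof -
              have "\<lfloor>u\<rfloor> = m" using that by (intro floor_unique) auto
              then show ?thesis by (simp add: frac_def)
            qed
          qed
        qed
        then have "((\<lambda>z. frac (y - z)) has_real_derivative 1 * (0 - 1)) (at z)"
          by (rule DERIV_chain2) (auto intro!: derivative_eq_intros)
        then have d: "((\<lambda>z. frac (y - z)) has_real_derivative - 1) (at z)" by simp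
        have "(bernoulli_kernel y has_real_derivative g z) (at z)"
          unfolding bernoulli_kernel_def[abs_def] bernoulli2_def g_def
          by (auto intro!: derivative_eq_intros d simp: field_simps)
        then show ?thesis by (simp add: has_real_derivative_iff_has_vector_derivative)
      qed
    qed (use s in auto)
    moreover have "set_integrable lborel {0..s} g" using g_bd by (intro bdd) auto
    from set_borel_integral_eq_integral[OF this]
    have "(g has_integral (LINT t:{0..s}|lborel. g t)) {0..s}" by (simp add: has_integral_integral)
    ultimately have "bernoulli_kernel y s - bernoulli_kernel y 0 = (LINT t:{0..s}|lborel. g t)"
      by (rule has_integral_unique)
    then show ?thesis by simp
  qed
  moreover have "g \<in> borel_measurable borel" by measurable
  ultimately show ?thesis using sq unfolding L2_derivative_def g_def[symmetric] by blast
qed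

lift_definition feature_map :: "real \<Rightarrow> periodic_sobolev" is bernoulli_kernel
  using bernoulli_kernel_fourier bernoulli_kernel_L2_derivative by blast

text \<open>The reproducing property, and with it the identification of the kernel.\<close>

lemma inner_feature_map:
  assumes y: "y \<in> {0..1}"
  shows "inner x (feature_map y) = fun_of x y"
proof -
  define g where "g = weak_derivative x"
  have D: "L2_derivative (fun_of x) g" by (simp add: g_def L2_derivative_weak_derivative)
  have [measurable]: "g \<in> borel_measurable borel" by (simp add: g_def)
  have gi: "set_integrable lborel {0..1} g" using L2_derivative_integrable[OF D] by simp
  have ti: "set_integrable lborel {0..1} (\<lambda>t. t * g t)"
    by (rule set_integrable_bound[OF gi])
      (auto simp: set_borel_measurable_def abs_mult mult_left_le_one_le)
  have yi: "set_integrable lborel {0..1} (\<lambda>t. indicator {0..y} t * g t)"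
    by (rule set_integrable_bound[OF gi])
      (auto simp: set_borel_measurable_def abs_mult indicator_def)
  obtain a b where ab: "uniform_limit UNIV (fourier_sum a b) (fun_of x) sequentially"
    by (rule fun_of_fourier)
  have val: "(LINT t:{0..s}|lborel. g t) = fun_of x s - fun_of x 0" if "s \<in> {0..1}" for s
    using L2_derivativeD(3)[OF D that] by linarith
  have g0: "(LINT t:{0..1}|lborel. g t) = 0"
    using val[of 1] fourier_limit_periodic[OF ab, of 0 1] by simp
  have ytot: "(LINT t:{0..1}|lborel. indicator {0..y} t * g t) = fun_of x y - fun_of x 0"
  proof -
    have "(LINT t:{0..1}|lborel. indicator {0..y} t * g t) = (LINT t:{0..y}|lborel. g t)"
      unfolding set_lebesgue_integral_def using y
      by (intro Bochner_Integration.integral_cong) (auto simp: indicator_def)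
    then show ?thesis using val y by simp
  qed
  have tg: "(LINT t:{0..1}|lborel. t * g t) = fun_of x 0"
  proof -
    define v where "v = (\<lambda>t. indicator {0..1} t * g t)"
    define u where "u = (indicator {0..1} :: real \<Rightarrow> real)"
    have [measurable]: "u \<in> borel_measurable borel" unfolding u_def by measurable
    have u: "integrable lborel u" unfolding u_def by simp
    define f where "f = (\<lambda>s t. u s * (if t \<le> s then v t else 0))"
    have [measurable]: "v \<in> borel_measurable borel" unfolding v_def by measurable
    have v: "integrable lborel v" using gi by (simp add: v_def set_integrable_def)
    have "integrable (lborel \<Otimes>\<^sub>M lborel) (\<lambda>p. u (fst p) * v (snd p))"
    proof (rule lborel_pair.Fubini_integrable)
      show "(\<lambda>p. u (fst p) * v (snd p)) \<in> borel_measurable (lborel \<Otimes>\<^sub>M lborel)"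
        by simp
    qed (use u v in \<open>auto simp: abs_mult\<close>)
    then have int: "integrable (lborel \<Otimes>\<^sub>M lborel) (case_prod f)"
    proof (rule Bochner_Integration.integrable_bound)
      show "case_prod f \<in> borel_measurable (lborel \<Otimes>\<^sub>M lborel)"
        unfolding f_def by measurable
    qed (auto simp: f_def)
    have "(LINT s|lborel. LINT t|lborel. f s t) = (LINT t|lborel. LINT s|lborel. f s t)"
      by (rule lborel_pair.Fubini_integral[OF int, symmetric])
    moreover have "(LINT t|lborel. f s t) = indicator {0..1} s * (fun_of x s - fun_of x 0)" for s
    proof (cases "s \<in> {0..1}")
      case True
      have "(LINT t|lborel. f s t) = (LINT t:{0..s}|lborel. g t)"
        unfolding set_lebesgue_integral_def f_def u_def v_def using True
        by (intro Bochner_Integration.integral_cong) (auto simp: indicator_def)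
      then show ?thesis using val True by simp
    qed (simp add: f_def u_def)
    moreover have "(LINT s|lborel. f s t) = indicator {0..1} t * (g t - t * g t)" for t
    proof (cases "t \<in> {0..1}")
      case True
      have "(LINT s|lborel. f s t) = (LINT s|lborel. indicator {t..1} s * g t)"
        unfolding f_def u_def v_def using True
        by (intro Bochner_Integration.integral_cong) (auto simp: indicator_def)
      then show ?thesis using True by (simp add: algebra_simps)
    next
      case False
      then have "(\<lambda>s. f s t) = (\<lambda>_. 0)" by (auto simp: f_def v_def)
      then show ?thesis using False by simp
    qed
    ultimately have eq: "(LINT s:{0..1}|lborel. fun_of x s - fun_of x 0)
        = (LINT t:{0..1}|lborel. g t - t * g t)"
      by (simp add: set_lebesgue_integral_def)
    have xi: "set_integrable lborel {0..1} (fun_of x)"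
      by (rule borel_integrable_atLeastAtMost') (rule fourier_limit_continuous[OF ab])
    have "(LINT s:{0..1}|lborel. fun_of x s) = 0"
      using set_borel_integral_eq_integral(2)[OF xi] fourier_limit_mean[OF ab] by (simp add: integral_unique)
    moreover have "(LINT s:{0..1}|lborel. fun_of x s - fun_of x 0)
        = (LINT s:{0..1}|lborel. fun_of x s) - (LINT s:{0..1::real}|lborel. fun_of x 0)"
      by (rule set_integral_diff(2)[OF xi]) (intro borel_integrable_atLeastAtMost' continuous_intros)
    moreover have "(LINT s:{0..1::real}|lborel. fun_of x 0) = fun_of x 0"
      by (simp add: set_lebesgue_integral_def)
    moreover have "(LINT t:{0..1}|lborel. g t - t * g t)
        = (LINT t:{0..1}|lborel. g t) - (LINT t:{0..1}|lborel. t * g t)"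
      by (rule set_integral_diff(2)[OF gi ti])
    ultimately show ?thesis using eq g0 by simp
  qed
  have "inner x (feature_map y) = (LINT t:{0..1}|lborel. g t * (1 / 2 - frac (y - t)))"
    by (rule inner_periodic_sobolev_eq[OF D]) (simp add: feature_map.rep_eq bernoulli_kernel_L2_derivative)
  also have "\<dots> = (LINT t:{0..1}|lborel. (- 1 / 2 - y) * g t + t * g t + indicator {0..y} t * g t)"
  proof (rule set_lebesgue_integral_cong_AE)
    have "AE t in lborel. t \<noteq> (0::real)" by (rule AE_lborel_singleton)
    then show "AE t\<in>{0..1} in lborel. g t * (1 / 2 - frac (y - t))
        = (- 1 / 2 - y) * g t + t * g t + indicator {0..y} t * g t"
    proof eventually_elim
      case (elim t)
      show ?case
      proof
        assume t: "t \<in> {0..1}"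
        have "frac (y - t) = y - t + 1 - indicator {0..y} t"
        proof (cases "t \<le> y")
          case True
          then have "\<lfloor>y - t\<rfloor> = 0" using t y elim by (intro floor_unique) auto
          then show ?thesis using True t by (simp add: frac_def)
        next
          case False
          then have "\<lfloor>y - t\<rfloor> = - 1" using t y by (intro floor_unique) auto
          then show ?thesis using False t by (simp add: frac_def)
        qed
        then show "g t * (1 / 2 - frac (y - t))
            = (- 1 / 2 - y) * g t + t * g t + indicator {0..y} t * g t"
          by (simp only:) (simp add: algebra_simps)
      qed
    qed
    show "(\<lambda>t. g t * (1 / 2 - frac (y - t))) \<in> borel_measurable lborel"
      unfolding frac_def by measurable
  qed measurable
  also have "\<dots> = (- 1 / 2 - y) * (LINT t:{0..1}|lborel. g t) + (LINT t:{0..1}|lborel. t * g t)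
      + (LINT t:{0..1}|lborel. indicator {0..y} t * g t)"
    using gi ti yi by (simp add: set_integral_add)
  also have "\<dots> = fun_of x y" by (simp add: g0 tg ytot)
  finally show ?thesis .
qed

lemma inner_feature_map_feature_map:
  assumes "y \<in> {0..1}" "z \<in> {0..1}"
  shows "inner (feature_map y) (feature_map z) = bernoulli_kernel y z"
  using inner_feature_map[OF assms(2), of "feature_map y"] by (simp add: feature_map.rep_eq)

definition marginal_polytope :: "periodic_sobolev set" where
  "marginal_polytope = convex hull (feature_map ` {0..1})"

definition argmin_on :: "('a \<Rightarrow> real) \<Rightarrow> 'a set \<Rightarrow> 'a set" where
  "argmin_on f S = {y. is_arg_min f (\<lambda>y. y \<in> S) y}"

text \<open>
  \<open>x\<close> and \<open>p\<close> are the iterates and the oracle answers of a run of \<open>T\<close> steps; only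
  \<open>x 0, \<dots>, x T\<close> and \<open>p 0, \<dots>, p (T - 1)\<close> are constrained.
\<close>

definition frank_wolfe ::
  "('a::real_normed_vector \<Rightarrow> real) \<Rightarrow> 'a set \<Rightarrow> (nat \<Rightarrow> real) \<Rightarrow> nat \<Rightarrow> (nat \<Rightarrow> 'a) \<Rightarrow> (nat \<Rightarrow> 'a) \<Rightarrow> bool"
  where
  "frank_wolfe f C \<eta> T x p \<longleftrightarrow>
     x 0 \<in> C \<and>
     (\<forall>t<T. p t \<in> argmin_on (\<lambda>q. frechet_derivative f (at (x t)) (q - x t)) C \<and>
            x (Suc t) = (1 - \<eta> t) *\<^sub>R x t + \<eta> t *\<^sub>R p t)"

lemma frechet_derivative_half_norm_squared:
  fixes w :: "'a::real_inner"
  shows "frechet_derivative (\<lambda>x. 1 / 2 * (norm x)\<^sup>2) (at w) = inner w"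
proof -
  have "((\<lambda>x. 1 / 2 * inner x x) has_derivative inner w) (at w)"
    by (auto intro!: derivative_eq_intros simp: inner_commute)
  then show ?thesis
    by (simp add: power2_norm_eq_inner frechet_derivative_at[symmetric])
qed

end

theory Submission
  imports Defs
begin

text \<open>
  Since \<open>\<eta>\<^sub>0 = 1\<close>, the iterate \<open>x\<^sub>t\<close> is the average of \<open>\<Phi>(z\<^sub>0), \<dots>, \<Phi>(z\<^sub>t\<^sub>-\<^sub>1)\<close>, where each \<open>z\<^sub>t\<close>
  minimizes the potential \<open>\<Sum>i<t. k(z\<^sub>i, y)\<close> of its predecessors. Whatever the starting point and
  however ties are broken, the first \<open>N = 2\<^sup>m\<close> points of such a greedy sequence are equidistant on
  the circle, with potential \<open>k(N z\<^sub>0, N y) / N\<close>. For the step from \<open>N\<close> to \<open>2N\<close>: the potential of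
  the first \<open>N\<close> points is minimal exactly at the midpoints of their lattice. The points from
  \<open>z\<^sub>N\<close> on stay at these midpoints and form a greedy sequence themselves, because a greedy
  continuation inside the midpoint lattice minimizes both parts of the potential at once. The
  duplication formula for \<open>B\<^sub>2\<close> then combines the two halves.
\<close>

section \<open>Identities for the kernel on the circle\<close>

lemma frac_eq_if_diff_Ints:
  fixes a b :: real
  assumes "a - b \<in> \<int>"
  shows "frac a = frac b"
proof -
  obtain k where "a - b = of_int k" using assms by (auto elim: Ints_cases)
  then have "a = b + of_int k" by linarith
  then show ?thesis by (simp add: frac_def)
qed

lemma bernoulli_kernel_cong:
  assumes "(a - b) - (c - d) \<in> \<int>"
  shows "bernoulli_kernel a b = bernoulli_kernel c d"
  unfolding bernoulli_kernel_def using frac_eq_if_diff_Ints[OF assms] by simp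

lemma bernoulli_kernel_same: "bernoulli_kernel a a = 1 / 12"
  by (simp add: bernoulli_kernel_def bernoulli2_def)

text \<open>Completing the square exposes the minimum \<open>- 1 / 24\<close>, taken exactly at
  antipodal points of the circle.\<close>

lemma bernoulli_kernel_square: "bernoulli_kernel a b = (frac (a - b) - 1 / 2)\<^sup>2 / 2 - 1 / 24"
  by (simp add: bernoulli_kernel_def bernoulli2_def power2_eq_square field_simps)

lemma bernoulli_kernel_ge: "- 1 / 24 \<le> bernoulli_kernel a b"
  by (simp add: bernoulli_kernel_square)

lemma bernoulli_kernel_eq_min_iff: "bernoulli_kernel a b = - 1 / 24 \<longleftrightarrow> a - b - 1 / 2 \<in> \<int>"
proof
  assume "bernoulli_kernel a b = - 1 / 24"
  then have "a - b - 1 / 2 = of_int \<lfloor>a - b\<rfloor>"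
    by (simp add: bernoulli_kernel_square frac_def)
  then show "a - b - 1 / 2 \<in> \<int>" by (metis Ints_of_int)
next
  assume "a - b - 1 / 2 \<in> \<int>"
  then have "frac (a - b) = frac (1 / 2 :: real)" by (rule frac_eq_if_diff_Ints)
  also have "\<dots> = 1 / 2" by (simp add: frac_eq)
  finally show "bernoulli_kernel a b = - 1 / 24" by (simp add: bernoulli_kernel_square)
qed

text \<open>This is \<open>B\<^sub>2(u) + B\<^sub>2(u + 1/2) = B\<^sub>2(2u) / 2\<close> for
  fractional parts. For \<open>u \<ge> 1 / 2\<close> both \<open>u + 1 / 2\<close> and
  \<open>2 * u\<close> wrap around, hence the case split.\<close>

lemma bernoulli_kernel_double:
  assumes "a' - a - 1 / 2 \<in> \<int>"
  shows "bernoulli_kernel a b + bernoulli_kernel a' b = bernoulli_kernel (2 * a) (2 * b) / 2"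
proof -
  define u where "u = frac (a - b)"
  have u: "0 \<le> u" "u < 1" by (simp_all add: u_def frac_lt_1)
  have au: "a - b - u \<in> \<int>" by (simp add: u_def frac_def)
  have 1: "bernoulli_kernel a b = 1 / 2 * bernoulli2 u"
    by (simp add: bernoulli_kernel_def u_def)
  have "(a' - b) - (u + 1 / 2) = (a' - a - 1 / 2) + (a - b - u)" by simp
  also have "\<dots> \<in> \<int>" using assms au by (rule Ints_add)
  finally have 2: "frac (a' - b) = frac (u + 1 / 2)" by (rule frac_eq_if_diff_Ints)
  have "(2 * a - 2 * b) - 2 * u = 2 * (a - b - u)" by simp
  also have "\<dots> \<in> \<int>" using au by (intro Ints_mult) auto
  finally have 3: "frac (2 * a - 2 * b) = frac (2 * u)" by (rule frac_eq_if_diff_Ints)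
  show ?thesis
  proof (cases "u < 1 / 2")
    case True
    then have "frac (u + 1 / 2) = u + 1 / 2" "frac (2 * u) = 2 * u" using u by (auto simp: frac_eq)
    then have "bernoulli_kernel a' b = 1 / 2 * bernoulli2 (u + 1 / 2)"
      "bernoulli_kernel (2 * a) (2 * b) = 1 / 2 * bernoulli2 (2 * u)"
      unfolding bernoulli_kernel_def 2 3 by simp_all
    then show ?thesis unfolding 1
      by (simp add: bernoulli2_def power2_eq_square field_simps)
  next
    case False
    have "frac (u + 1 / 2) = frac (u - 1 / 2)" "frac (2 * u) = frac (2 * u - 1)"
      by (rule frac_eq_if_diff_Ints, simp)+
    moreover have "frac (u - 1 / 2) = u - 1 / 2" "frac (2 * u - 1) = 2 * u - 1"
      using u False by (auto simp: frac_eq)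
    ultimately have "bernoulli_kernel a' b = 1 / 2 * bernoulli2 (u - 1 / 2)"
      "bernoulli_kernel (2 * a) (2 * b) = 1 / 2 * bernoulli2 (2 * u - 1)"
      unfolding bernoulli_kernel_def 2 3 by simp_all
    then show ?thesis unfolding 1
      by (simp add: bernoulli2_def power2_eq_square field_simps)
  qed
qed

section \<open>Potentials and greedy sequences\<close>

definition potential :: "(nat \<Rightarrow> real) \<Rightarrow> nat \<Rightarrow> real \<Rightarrow> real" where
  "potential z n y = (\<Sum>i<n. bernoulli_kernel (z i) y)"

text \<open>Competitors \<open>y\<close> range over all reals, so that shifted points such as
  midpoints can be compared without reducing them modulo 1.\<close>

definition greedy :: "(nat \<Rightarrow> real) \<Rightarrow> nat \<Rightarrow> bool" where
  "greedy z n \<longleftrightarrow> (\<forall>t<n. \<forall>y. potential z t (z t) \<le> potential z t y)"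

lemma potential_frac: "potential z n (frac y) = potential z n y"
  unfolding potential_def by (intro sum.cong refl bernoulli_kernel_cong) (simp add: frac_def)

lemma potential_cong: "(\<And>i. i < n \<Longrightarrow> z i = w i) \<Longrightarrow> potential z n = potential w n"
  by (simp add: potential_def fun_eq_iff)

lemma potential_add: "potential z (n + k) y = potential z n y + potential (\<lambda>i. z (n + i)) k y"
  by (induction k) (simp_all add: potential_def)

lemma potential_attains_min: "\<exists>u. \<forall>y. potential z n u \<le> potential z n y"
proof -
  have "continuous_on {0..1} (potential z n)"
    unfolding potential_def[abs_def]
    by (intro continuous_intros fourier_limit_continuous[OF bernoulli_kernel_fourier])
  then obtain u where u: "\<forall>y\<in>{0..1}. potential z n u \<le> potential z n y"
    using continuous_attains_inf[of "{0..1::real}" "potential z n"] by auto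
  have "potential z n u \<le> potential z n y" for y
    using bspec[OF u, of "frac y"] by (simp add: potential_frac frac_lt_1 less_imp_le)
  then show ?thesis by blast
qed

lemma greedy_Suc:
  "greedy z (Suc n) \<longleftrightarrow> greedy z n \<and> (\<forall>y. potential z n (z n) \<le> potential z n y)"
  by (auto simp: greedy_def less_Suc_eq)

lemma greedy_cong:
  assumes "\<And>i. i < n \<Longrightarrow> z i = w i"
  shows "greedy z n \<longleftrightarrow> greedy w n"
  unfolding greedy_def using assms potential_cong[of _ z w] by simp

text \<open>Completes a greedy prefix to a block of length \<open>2 ^ m\<close>, the only lengths
  about which the equidistribution result speaks.\<close>

lemma greedy_extend:
  assumes "greedy w j" "j \<le> n"
  shows "\<exists>v. greedy v n \<and> (\<forall>i<j. v i = w i)"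
  using assms(2)
proof (induction n rule: dec_induct)
  case base
  then show ?case using assms(1) by blast
next
  case (step n)
  then obtain v where v: "greedy v n" "\<forall>i<j. v i = w i" by blast
  obtain u where u: "\<forall>y. potential v n u \<le> potential v n y"
    using potential_attains_min by blast
  have "greedy (v(n := u)) n" using v(1) greedy_cong[of n "v(n := u)" v] by simp
  moreover have "potential (v(n := u)) n = potential v n" by (rule potential_cong) simp
  ultimately have "greedy (v(n := u)) (Suc n)" using u by (simp add: greedy_Suc)
  moreover have "\<forall>i<j. (v(n := u)) i = w i" using v(2) step(1) by simp
  ultimately show ?case by blast
qed

section \<open>Equidistribution at powers of two\<close>

text \<open>The induction keeps \<open>z\<close> arbitrary because the hypothesis is applied to the
  first half, to the second half, and to greedy completions of prefixes of the second half.\<close>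

lemma greedy_equidistant:
  assumes "greedy z (2 ^ m)"
  shows "potential z (2 ^ m) y = bernoulli_kernel (2 ^ m * z 0) (2 ^ m * y) / 2 ^ m"
    and "i < 2 ^ m \<Longrightarrow> 2 ^ m * z i - 2 ^ m * z 0 \<in> \<int>"
proof -
  have "(\<forall>y. potential z (2 ^ m) y = bernoulli_kernel (2 ^ m * z 0) (2 ^ m * y) / 2 ^ m)
      \<and> (\<forall>i<2 ^ m. 2 ^ m * z i - 2 ^ m * z 0 \<in> \<int>)"
    using assms
  proof (induction m arbitrary: z)
    case 0
    then show ?case by (simp add: potential_def)
  next
    case (Suc m)
    define N :: nat where "N = 2 ^ m"
    define R :: real where "R = 2 ^ m"
    have R: "R > 0" by (simp add: R_def)
    have N: "N > 0" "2 ^ Suc m = N + N" by (simp_all add: N_def)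
    define w where "w = (\<lambda>i. z (N + i))"
    have IH: "potential v N y = bernoulli_kernel (R * v 0) (R * y) / R"
      "i < N \<Longrightarrow> R * v i - R * v 0 \<in> \<int>" if "greedy v N" for v y i
      using Suc.IH[of v] that unfolding N_def R_def by blast+
    have min_z: "potential z t (z t) \<le> potential z t y" if "t < N + N" for t y
      using Suc.prems that unfolding greedy_def N(2) by blast
    have gz: "greedy z N" using min_z unfolding greedy_def by auto
    have ge: "potential z N y \<ge> - 1 / 24 / R" for y
      unfolding IH(1)[OF gz] using bernoulli_kernel_ge R by (intro divide_right_mono) auto
    \<comment> \<open>The right-hand side says that \<open>y\<close> is a midpoint of the lattice of
      spacing \<open>1 / R\<close> through \<open>z 0\<close>.\<close>
    have mid: "potential z N y = - 1 / 24 / R \<longleftrightarrow> R * z 0 - R * y - 1 / 2 \<in> \<int>" for y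
      unfolding IH(1)[OF gz] bernoulli_kernel_eq_min_iff[symmetric] divide_cancel_right
      using R by simp
    have w0: "R * z 0 - R * w 0 - 1 / 2 \<in> \<int>"
    proof -
      have "potential z N (w 0) \<le> potential z N (z 0 - 1 / (2 * R))"
        using min_z[of N] N by (simp add: w_def)
      also have "\<dots> = - 1 / 24 / R" unfolding mid using R by (simp add: right_diff_distrib)
      finally show ?thesis using ge[of "w 0"] unfolding mid[symmetric] by linarith
    qed
    have gw: "greedy w j" if "j \<le> N" for j
      using that
    proof (induction j)
      case 0
      then show ?case by (simp add: greedy_def)
    next
      case (Suc j)
      then have gj: "greedy w j" by simp
      have "potential w j (w j) \<le> potential w j y" for y
      proof (cases "j = 0")
        case False
        \<comment> \<open>As \<open>j > 0\<close>, \<open>v 0 = w 0\<close>, so the induction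
          hypothesis for \<open>v\<close> places \<open>v j\<close> at a midpoint. There the
          potential of the first half is minimal; since \<open>w j\<close> minimizes the total
          potential, it does at least as well as \<open>v j\<close> on the part due to
          \<open>w\<close>, which \<open>v j\<close> minimizes.\<close>
        obtain v where v: "greedy v N" "\<forall>i<j. v i = w i"
          using greedy_extend[OF gj, of N] Suc.prems by auto
        have pv: "potential v j = potential w j" using v(2) by (intro potential_cong) simp
        have "R * v j - R * v 0 \<in> \<int>" using IH(2)[OF v(1), of j] Suc.prems by simp
        with w0 have "R * z 0 - R * w 0 - 1 / 2 - (R * v j - R * v 0) \<in> \<int>" by (rule Ints_diff)
        then have "potential z N (v j) = - 1 / 24 / R" unfolding mid using False v(2) by (simp add: algebra_simps)
        then have "potential z N (v j) \<le> potential z N (w j)" using ge[of "w j"] by simp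
        moreover have "potential z (N + j) (w j) \<le> potential z (N + j) (v j)"
          using min_z[of "N + j"] Suc.prems by (simp add: w_def)
        ultimately have "potential w j (w j) \<le> potential w j (v j)"
          unfolding potential_add w_def[symmetric] by linarith
        also have "\<dots> \<le> potential w j y"
          using v(1) Suc.prems unfolding greedy_def pv[symmetric] by auto
        finally show ?thesis .
      qed (simp add: potential_def)
      then show ?case using gj by (simp add: greedy_Suc)
    qed
    then have gwN: "greedy w N" by simp
    have mid0: "R * w 0 - R * z 0 - 1 / 2 \<in> \<int>"
    proof -
      have "R * w 0 - R * z 0 - 1 / 2 = - (R * z 0 - R * w 0 - 1 / 2) - 1" by simp
      also have "\<dots> \<in> \<int>" by (rule Ints_diff[OF Ints_minus[OF w0] Ints_1])
      finally show ?thesis .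
    qed
    have "potential z (N + N) y = bernoulli_kernel (2 * R * z 0) (2 * R * y) / (2 * R)" for y
    proof -
      have "potential z (N + N) y
          = (bernoulli_kernel (R * z 0) (R * y) + bernoulli_kernel (R * w 0) (R * y)) / R"
        unfolding potential_add w_def[symmetric] IH(1)[OF gz] IH(1)[OF gwN]
        by (simp add: add_divide_distrib)
      then show ?thesis by (simp add: bernoulli_kernel_double[OF mid0] mult.assoc)
    qed
    moreover have "2 * R * z i - 2 * R * z 0 \<in> \<int>" if "i < N + N" for i
    proof (cases "i < N")
      case True
      then have "2 * (R * z i - R * z 0) \<in> \<int>" using IH(2)[OF gz] by (intro Ints_mult) auto
      then show ?thesis by (simp add: algebra_simps)
    next
      case False
      then have "i - N < N" "z i = w (i - N)" using that by (auto simp: w_def)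
      \<comment> \<open>Doubling turns the half-integer offset between the two lattices into an
        integer.\<close>
      then have "2 * (R * z i - R * w 0) + 2 * (R * w 0 - R * z 0 - 1 / 2) + 1 \<in> \<int>"
        using IH(2)[OF gwN, of "i - N"] mid0 by (intro Ints_add Ints_mult) auto
      then show ?thesis by (simp add: algebra_simps)
    qed
    moreover have "(2::real) ^ Suc m = 2 * R" by (simp add: R_def)
    ultimately show ?case unfolding N(2) by simp
  qed
  then show "potential z (2 ^ m) y = bernoulli_kernel (2 ^ m * z 0) (2 ^ m * y) / 2 ^ m"
    and "i < 2 ^ m \<Longrightarrow> 2 ^ m * z i - 2 ^ m * z 0 \<in> \<int>"
    by blast+
qed

section \<open>Norms of greedy sums and the Frank-Wolfe iterates\<close>

text \<open>The squared norm is the potential summed over its own points. By equidistance each of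
  the \<open>2 ^ m\<close> points contributes \<open>k(0, 0) / 2 ^ m\<close>, with
  \<open>k(0, 0) = 1 / 12\<close>.\<close>

lemma norm_sum_feature_map_greedy:
  assumes "greedy z (2 ^ m)" and z: "\<And>i. i < 2 ^ m \<Longrightarrow> z i \<in> {0..1}"
  shows "(norm (\<Sum>i<2 ^ m. feature_map (z i)))\<^sup>2 = 1 / 12"
proof -
  have "(norm (\<Sum>i<2 ^ m. feature_map (z i)))\<^sup>2
      = (\<Sum>j<2 ^ m. potential z (2 ^ m) (z j))"
    unfolding power2_norm_eq_inner inner_sum_left inner_sum_right potential_def
    by (intro sum.cong refl inner_feature_map_feature_map z) auto
  also have "\<dots> = (\<Sum>j<(2::nat) ^ m. 1 / 12 / 2 ^ m)"
  proof (rule sum.cong[OF refl])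
    fix j :: nat assume "j \<in> {..<2 ^ m}"
    then have "2 ^ m * z j - 2 ^ m * z 0 \<in> \<int>" by (intro greedy_equidistant(2)[OF assms(1)]) simp
    then have "- (2 ^ m * z j - 2 ^ m * z 0) \<in> \<int>" by (rule Ints_minus)
    then have "bernoulli_kernel (2 ^ m * z 0) (2 ^ m * z j) = bernoulli_kernel 0 0"
      by (intro bernoulli_kernel_cong) simp
    then show "potential z (2 ^ m) (z j) = 1 / 12 / 2 ^ m"
      unfolding greedy_equidistant(1)[OF assms(1)] bernoulli_kernel_same by (rule arg_cong)
  qed
  also have "\<dots> = 1 / 12" by simp
  finally show ?thesis .
qed

theorem theorem6p1:
  fixes f :: "periodic_sobolev \<Rightarrow> real"
    and T :: nat
    and \<eta> :: "nat \<Rightarrow> real"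
    and x p :: "nat \<Rightarrow> periodic_sobolev"
  assumes f: "f = (\<lambda>x. 1 / 2 * (norm x)\<^sup>2)"
    and step_size: "\<And>t. \<eta> t = 1 / (real t + 1)"
    and iterates: "frank_wolfe f marginal_polytope \<eta> T x p"
    and tie_breaking: "\<And>t. t < T \<Longrightarrow>
      \<exists>z\<in>argmin_on (\<lambda>y. inner (x t) (feature_map y)) {0..1}.
        (\<forall>y\<in>argmin_on (\<lambda>y. inner (x t) (feature_map y)) {0..1}. z \<le> y) \<and> p t = feature_map z"
  shows "\<forall>t\<in>{1..T}. (\<exists>m::nat. t = 2 ^ m) \<longrightarrow> f (x t) = 1 / (24 * (real t)\<^sup>2)"
proof (intro ballI impI, elim exE)
  fix t m :: nat
  assume t: "t \<in> {1..T}" and tm: "t = 2 ^ m"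
  obtain z where z: "\<And>s. s < T \<Longrightarrow> z s \<in> argmin_on (\<lambda>y. inner (x s) (feature_map y)) {0..1}"
    and p: "\<And>s. s < T \<Longrightarrow> p s = feature_map (z s)"
    using tie_breaking by metis
  have z01: "z s \<in> {0..1}" if "s < T" for s
    using z[OF that] by (simp add: argmin_on_def is_arg_min_def)
  \<comment> \<open>The factor \<open>s\<close> makes both sides vanish at \<open>s = 0\<close>,
    whatever the starting point \<open>x 0\<close>.\<close>
  have avg: "real s *\<^sub>R x s = (\<Sum>i<s. feature_map (z i))" if "s \<le> T" for s
    using that
  proof (induction s)
    case (Suc s)
    then have "x (Suc s) = (1 - \<eta> s) *\<^sub>R x s + \<eta> s *\<^sub>R feature_map (z s)"
      using iterates p[of s] by (simp add: frank_wolfe_def)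
    moreover have "real (Suc s) * (1 - \<eta> s) = real s" "real (Suc s) * \<eta> s = 1"
      by (simp_all add: step_size field_simps)
    ultimately have "real (Suc s) *\<^sub>R x (Suc s) = real s *\<^sub>R x s + feature_map (z s)"
      by (simp only: scaleR_add_right scaleR_scaleR scaleR_one)
    then show ?case using Suc by simp
  qed simp
  have pot: "potential z s y = real s * inner (x s) (feature_map y)"
    if "s \<le> T" "y \<in> {0..1}" for s y
  proof -
    have "real s * inner (x s) (feature_map y) = inner (real s *\<^sub>R x s) (feature_map y)" by simp
    also have "\<dots> = potential z s y"
      unfolding avg[OF that(1)] inner_sum_left potential_def using that z01
      by (intro sum.cong refl inner_feature_map_feature_map) auto
    finally show ?thesis by simp
  qed
  have "greedy z T"
    unfolding greedy_def
  proof (intro allI impI)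
    fix s and y :: real assume s: "s < T"
    have y: "frac y \<in> {0..1}" by (simp add: frac_lt_1 less_imp_le)
    have "inner (x s) (feature_map (z s)) \<le> inner (x s) (feature_map (frac y))"
      using z[OF s] y by (auto simp: argmin_on_def is_arg_min_def not_less)
    then have "potential z s (z s) \<le> potential z s (frac y)"
      using s y z01[OF s] by (simp add: pot mult_left_mono)
    then show "potential z s (z s) \<le> potential z s y" by (simp add: potential_frac)
  qed
  then have "greedy z (2 ^ m)" using t tm by (auto simp: greedy_def)
  then have "(norm (real t *\<^sub>R x t))\<^sup>2 = 1 / 12"
    using norm_sum_feature_map_greedy[of z m] avg[of t] z01 t tm by simp
  then show "f (x t) = 1 / (24 * (real t)\<^sup>2)"
    using t by (simp add: f power_mult_distrib field_simps)
qed

end
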